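(* Let $1\le p<\infty$ and $0<\lambda<1$. Then the Morrey space $L^{p,\lambda}(\mathbb{T})$ cannot be renormed so that it becomes rearrangement-invariant. That is, there is no rearrangement-invariant Banach function space $X(\mathbb{T})$ that coincides with $L^{p,\lambda}(\mathbb{T})$ as a set and whose norm is equivalent to $\|\cdot\|_{L^{p,\lambda}}$.
   Context: $\mathbb{T}$ is the unit circle in $\mathbb{C}$ and $m$ is the Lebesgue (arc length) measure on $\mathbb{T}$ normalised so that $m(\mathbb{T})=1$. For $1\le p<\infty$ and $0\le\lambda<1$, the Morrey space $L^{p,\lambda}(\mathbb{T})$ is the collection of all measurable functions $f:\mathbb{T}\to\mathbb{C}$ such that $$\|f\|_{L^{p,\lambda}}:=\sup_{\omega\subset\mathbb{T}}\left(\frac{1}{m(\omega)^\lambda}\int_\omega |f(\zeta)|^p\,dm(\zeta)\right)^{1/p}<\infty,$$ where the supremum is taken over all arcs $\omega\subset\mathbb{T}$ (of positive measure). Banach function spaces are understood in the sense of Bennett and Sharpley: a Banach function norm is a map $\rho$ from the set of measurable functions $\mathbb{T}\to[0,\infty]$ to $[0,\infty]$ such that, for all measurable $f,g,f_n:\mathbb{T}\to[0,\infty]$ $(n\in\mathbb{N})$, all constants $a\ge 0$ and all measurable $E\subset\mathbb{T}$: (1) $\rho(f)=0$ if and only if $f=0$ a.e., $\rho(af)=a\rho(f)$, $\rho(f+g)\le\rho(f)+\rho(g)$; (2) $0\le g\le f$ a.e. implies $\rho(g)\le\rho(f)$; (3) $0\le f_n\uparrow f$ a.e. implies $\rho(f_n)\uparrow\rho(f)$;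 (4) $\rho(\chi_E)<\infty$; (5) $\int_E f\,dm\le C_E\,\rho(f)$ for some constant $C_E\in(0,\infty)$ depending on $E$ and $\rho$ but not on $f$. The associated Banach function space $X(\mathbb{T})$ is the set of all measurable $f:\mathbb{T}\to\mathbb{C}$ (functions equal a.e. being identified) with $\|f\|_X:=\rho(|f|)<\infty$; the quantity $\|f\|_X=\rho(|f|)\in[0,\infty]$ is defined for every measurable $f$. Two measurable functions $f,g:\mathbb{T}\to\mathbb{C}$ are equimeasurable if $m\{\zeta\in\mathbb{T}:|f(\zeta)|>s\}=m\{\zeta\in\mathbb{T}:|g(\zeta)|>s\}$ for all $s\ge 0$. A Banach function space $X(\mathbb{T})$ is rearrangement-invariant if $\|f\|_X=\|g\|_X$ for every pair of equimeasurable functions $f,g:\mathbb{T}\to\mathbb{C}$. *)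

theory Defs
  imports "HOL-Analysis.Analysis"
begin

section \<open>The unit circle with normalised arc length\<close>

abbreviation unit_circle :: "complex set"
  where "unit_circle \<equiv> sphere 0 1"

text \<open>Completing the image measure makes all Lebesgue measurable subsets of the circle measurable,
  not only the Borel ones.\<close>
definition circle_measure :: "complex measure"
  where "circle_measure = completion
    (distr (restrict_space lborel {0..<1}) (restrict_space borel unit_circle) (\<lambda>t. cis (2 * pi * t)))"

lemma space_circle_measure: "space circle_measure = unit_circle"
  by (simp add: circle_measure_def space_restrict_space)

lemma emeasure_circle_measure_space: "emeasure circle_measure unit_circle = 1"
proof -
  have "(\<lambda>t. cis (2 * pi * t)) \<in>
      measurable (restrict_space lborel {0..<1}) (restrict_space borel unit_circle)"
    by (intro measurable_restrict_space2 measurable_restrict_space1)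
       (auto intro!: borel_measurable_continuous_onI continuous_intros)
  moreover have "unit_circle \<in> sets (restrict_space borel unit_circle)"
    by (metis sets.top space_restrict_space2 borel_closed closed_sphere sets.Int_space_eq2)
  moreover have "{x::real. 0 \<le> x \<and> x < 1} = {0..<1}"
    by auto
  ultimately show ?thesis
    by (simp add: circle_measure_def emeasure_distr)
       (subst emeasure_restrict_space, auto simp: space_restrict_space vimage_def Int_def)
qed

text \<open>The arcs of positive measure, with or without their endpoints; an interval of length at
  least \<open>2 * pi\<close> gives the whole circle.\<close>
definition circle_arcs :: "complex set set"
  where "circle_arcs = {cis ` I | I. is_interval I \<and> 0 < emeasure circle_measure (cis ` I)}"


section \<open>Morrey spaces\<close>

text \<open>Powers with a positive real exponent on \<open>[0, \<infinity>]\<close>.\<close>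
definition ennreal_powr :: "ennreal \<Rightarrow> real \<Rightarrow> ennreal"
  where "ennreal_powr x a = (if x = \<infinity> then \<infinity> else ennreal (enn2real x powr a))"

definition morrey_norm :: "real \<Rightarrow> real \<Rightarrow> (complex \<Rightarrow> complex) \<Rightarrow> ennreal"
  where "morrey_norm p l f = (SUP \<omega>\<in>circle_arcs.
    ennreal_powr (ennreal (1 / measure circle_measure \<omega> powr l) *
      (\<integral>\<^sup>+\<zeta>\<in>\<omega>. ennreal (norm (f \<zeta>) powr p) \<partial>circle_measure)) (1 / p))"

text \<open>Here and below, function spaces are sets of representatives: functions on the whole complex
  plane whose values off the circle are irrelevant. The norms respect almost everywhere equality,
  so two such spaces agree iff their sets of equivalence classes do.\<close>
definition morrey_space :: "real \<Rightarrow> real \<Rightarrow> (complex \<Rightarrow> complex) set"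
  where "morrey_space p l = {f \<in> borel_measurable circle_measure. morrey_norm p l f < \<infinity>}"


section \<open>Banach function spaces\<close>

definition banach_function_norm :: "'a measure \<Rightarrow> (('a \<Rightarrow> ennreal) \<Rightarrow> ennreal) \<Rightarrow> bool"
  where "banach_function_norm M \<rho> \<longleftrightarrow>
    (\<forall>f \<in> borel_measurable M. \<rho> f = 0 \<longleftrightarrow> (AE x in M. f x = 0)) \<and>
    (\<forall>f \<in> borel_measurable M. \<forall>a::real. a \<ge> 0 \<longrightarrow> \<rho> (\<lambda>x. ennreal a * f x) = ennreal a * \<rho> f) \<and>
    (\<forall>f \<in> borel_measurable M. \<forall>g \<in> borel_measurable M. \<rho> (\<lambda>x. f x + g x) \<le> \<rho> f + \<rho> g) \<and>
    (\<forall>f \<in> borel_measurable M. \<forall>g \<in> borel_measurable M. (AE x in M. g x \<le> f x) \<longrightarrow> \<rho> g \<le> \<rho> f) \<and>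
    (\<forall>F. \<forall>f \<in> borel_measurable M. (\<forall>n::nat. F n \<in> borel_measurable M) \<longrightarrow>
      (AE x in M. incseq (\<lambda>n. F n x) \<and> (\<lambda>n. F n x) \<longlonglongrightarrow> f x) \<longrightarrow>
      incseq (\<lambda>n. \<rho> (F n)) \<and> (\<lambda>n. \<rho> (F n)) \<longlonglongrightarrow> \<rho> f) \<and>
    (\<forall>E \<in> sets M. \<rho> (indicator E) < \<infinity>) \<and>
    (\<forall>E \<in> sets M. \<exists>C::real. C > 0 \<and>
      (\<forall>f \<in> borel_measurable M. (\<integral>\<^sup>+x\<in>E. f x \<partial>M) \<le> ennreal C * \<rho> f))"

definition bfs_norm :: "(('a \<Rightarrow> ennreal) \<Rightarrow> ennreal) \<Rightarrow> ('a \<Rightarrow> complex) \<Rightarrow> ennreal"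
  where "bfs_norm \<rho> f = \<rho> (\<lambda>x. ennreal (norm (f x)))"

definition bfs :: "'a measure \<Rightarrow> (('a \<Rightarrow> ennreal) \<Rightarrow> ennreal) \<Rightarrow> ('a \<Rightarrow> complex) set"
  where "bfs M \<rho> = {f \<in> borel_measurable M. bfs_norm \<rho> f < \<infinity>}"

definition equimeasurable :: "'a measure \<Rightarrow> ('a \<Rightarrow> complex) \<Rightarrow> ('a \<Rightarrow> complex) \<Rightarrow> bool"
  where "equimeasurable M f g \<longleftrightarrow> (\<forall>s::real. s \<ge> 0 \<longrightarrow>
    emeasure M {x \<in> space M. norm (f x) > s} = emeasure M {x \<in> space M. norm (g x) > s})"

definition rearrangement_invariant :: "'a measure \<Rightarrow> (('a \<Rightarrow> ennreal) \<Rightarrow> ennreal) \<Rightarrow> bool"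
  where "rearrangement_invariant M \<rho> \<longleftrightarrow>
    (\<forall>f \<in> borel_measurable M. \<forall>g \<in> borel_measurable M.
      equimeasurable M f g \<longrightarrow> bfs_norm \<rho> f = bfs_norm \<rho> g)"

definition equivalent_norms_on :: "'f set \<Rightarrow> ('f \<Rightarrow> ennreal) \<Rightarrow> ('f \<Rightarrow> ennreal) \<Rightarrow> bool"
  where "equivalent_norms_on S N N' \<longleftrightarrow> (\<exists>c C :: real. c > 0 \<and> C > 0 \<and>
    (\<forall>f \<in> S. ennreal c * N' f \<le> N f \<and> N f \<le> ennreal C * N' f))"

end

theory Submission
  imports Defs
begin

text \<open>Compare the indicator of one arc of measure \<open>s\<close> with that of \<open>n\<close> evenly spaced arcs of
  measure \<open>s / n\<close>. They are equimeasurable, but the Morrey norm of the first is at least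
  \<open>s powr ((1 - l) / p)\<close>, while for large \<open>n\<close> the second is spread so evenly that its norm is at
  most \<open>(6 * s) powr (1 / p)\<close>. Letting \<open>s\<close> tend to 0 rules out any equivalent
  rearrangement-invariant norm.\<close>

section \<open>Parametrisation of the circle by full turns\<close>

text \<open>Counting angles in full turns makes the normalised measure plain length on
  \<open>{0..<1}\<close>.\<close>

abbreviation turn :: "real \<Rightarrow> complex"
  where "turn t \<equiv> cis (2 * pi * t)"

text \<open>The \<open>n\<close> evenly spaced arcs, in turns; each interval is called a tooth
  below. Closed teeth make the comb and its image under \<open>turn\<close> compact, hence
  Borel.\<close>

definition comb :: "nat \<Rightarrow> real \<Rightarrow> real set"
  where "comb n s = (\<Union>j<n. {real j / n .. (real j + s) / n})"

text \<open>One side is in turns and the other in radians because \<open>circle_arcs\<close> is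
  stated through \<open>cis\<close>.\<close>

lemma turn_eq_cis_iff: "turn t = cis x \<longleftrightarrow> (\<exists>k::int. x = 2 * pi * (t + k))"
proof -
  have "turn t = cis x \<longleftrightarrow> sin x = sin (2 * pi * t) \<and> cos x = cos (2 * pi * t)"
    by (auto simp: complex_eq_iff)
  also have "\<dots> \<longleftrightarrow> (\<exists>k::int. x = 2 * pi * t + 2 * pi * k)"
    using sin_cos_eq_iff[of x "2 * pi * t"] by auto
  finally show ?thesis
    by (simp add: algebra_simps)
qed

lemma inj_on_turn: "inj_on turn {0..<1}"
proof (rule inj_onI)
  fix t u :: real
  assume t: "t \<in> {0..<1}" and u: "u \<in> {0..<1}" and "turn t = turn u"
  then obtain k :: int where "u = t + k"
    using turn_eq_cis_iff[of t "2 * pi * u"] by auto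
  moreover from this t u have "k = 0"
    by auto
  ultimately show "t = u"
    by simp
qed

lemma turn_range: "unit_circle = turn ` {0..<1}"
proof safe
  fix z :: complex
  assume "z \<in> unit_circle"
  then have "norm z = 1" "z \<noteq> 0"
    by auto
  then have "z = cis (Arg z)"
    by (simp add: cis_Arg sgn_div_norm)
  then obtain x where x: "z = cis x" ..
  have "turn (frac (x / (2 * pi))) = cis x"
    unfolding turn_eq_cis_iff
    by (rule exI[of _ "\<lfloor>x / (2 * pi)\<rfloor>"]) (simp add: frac_def)
  then show "z \<in> turn ` {0..<1}"
    unfolding x by (intro image_eqI[of _ _ "frac (x / (2 * pi))"]) (auto simp: frac_lt_1)
qed auto

text \<open>Completion keeps the measure of Borel sets, so a measure on the circle becomes the
  length of a preimage. All later computations of measures of combs and arcs rest on this.\<close>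

lemma circle_measure_borel:
  assumes "B \<in> sets borel" "B \<subseteq> unit_circle"
  shows "B \<in> sets circle_measure"
    and "measure circle_measure B = measure lborel {t \<in> {0..<1}. turn t \<in> B}"
proof -
  let ?D = "distr (restrict_space lborel {0..<1}) (restrict_space borel unit_circle) turn"
  have B: "B \<in> sets (restrict_space borel unit_circle)"
    using assms by (auto simp: sets_restrict_space)
  then show "B \<in> sets circle_measure"
    unfolding circle_measure_def by (intro sets_completionI_sets) simp
  have meas: "turn \<in> measurable (restrict_space lborel {0..<1}) (restrict_space borel unit_circle)"
    by (intro measurable_restrict_space2 measurable_restrict_space1)
       (auto intro!: borel_measurable_continuous_onI continuous_intros)
  have "measure circle_measure B = measure ?D B"
    unfolding circle_measure_def using B by (intro measure_completion) simp
  also have "\<dots> = measure (restrict_space lborel {0..<1}) {t \<in> {0..<1}. turn t \<in> B}"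
    by (subst measure_distr[OF meas B])
       (auto simp: space_restrict_space vimage_def Int_def intro!: arg_cong2[where f = measure])
  also have "\<dots> = measure lborel {t \<in> {0..<1}. turn t \<in> B}"
    by (intro measure_restrict_space) auto
  finally show "measure circle_measure B = measure lborel {t \<in> {0..<1}. turn t \<in> B}" .
qed

lemma finite_measure_circle_measure: "finite_measure circle_measure"
  by (rule finite_measureI) (simp add: space_circle_measure emeasure_circle_measure_space)

section \<open>Arcs and their preimages in the unit interval\<close>

text \<open>Arcs may contain or omit endpoints. Squeezing between an open and a closed interval of
  equal length avoids treating the four kinds separately.\<close>

lemma interval_between:
  fixes T :: "real set"
  assumes "is_interval T" "T \<subseteq> {0..<1}"
  obtains a b where "0 \<le> a" "a \<le> b" "b \<le> 1" "{a<..<b} \<subseteq> T" "T \<subseteq> {a..b}"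
proof (cases "T = {}")
  case True
  then show ?thesis
    using that[of 0 0] by auto
next
  case False
  have bdd: "bdd_below T" "bdd_above T"
    using assms(2) by (auto intro: bdd_below_mono[of "{0..<1}"] bdd_above_mono[of "{0..<1}"])
  show ?thesis
  proof (rule that[of "Inf T" "Sup T"])
    show "0 \<le> Inf T"
      using False assms(2) by (intro cInf_greatest) auto
    show "Sup T \<le> 1"
      using False assms(2) by (intro cSup_least) auto
    show "Inf T \<le> Sup T"
      using False bdd by (intro cInf_le_cSup)
    show "T \<subseteq> {Inf T..Sup T}"
      using bdd by (auto intro: cInf_lower cSup_upper)
    show "{Inf T<..<Sup T} \<subseteq> T"
    proof
      fix x assume x: "x \<in> {Inf T<..<Sup T}"
      then obtain u v where "u \<in> T" "u < x" "v \<in> T" "x < v"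
        using False bdd by (auto simp: cInf_less_iff less_cSup_iff)
      then show "x \<in> T"
        using assms(1) unfolding is_interval_1 by (meson less_imp_le)
    qed
  qed
qed

lemma interval_borel:
  fixes T :: "real set"
  assumes "{a<..<b} \<subseteq> T" "T \<subseteq> {a..b}"
  shows "T \<in> sets borel"
proof -
  have T: "T = {a<..<b} \<union> (T \<inter> {a, b})"
    using assms by fastforce
  have "countable (T \<inter> {a, b})"
    by simp
  then have "T \<inter> {a, b} \<in> sets borel"
    by (rule sets.countable[rotated]) simp
  then show ?thesis
    by (subst T) simp
qed

text \<open>The image of \<open>{a..b}\<close> is compact, and the image of \<open>T\<close> can
  differ from it only at the images of \<open>a\<close> and \<open>b\<close>. Both points are
  removed and those that belong are put back.\<close>

lemma turn_image_borel:
  assumes "{a<..<b} \<subseteq> T" "T \<subseteq> {a..b}"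
  shows "turn ` T \<in> sets borel"
proof -
  let ?F = "turn ` {a, b}"
  have T: "turn ` T = (turn ` {a..b} - ?F) \<union> (turn ` T \<inter> ?F)" (is "_ = ?R")
  proof
    show "?R \<subseteq> turn ` T"
    proof
      fix z assume "z \<in> ?R"
      then consider t where "t \<in> {a..b}" "z = turn t" "t \<noteq> a" "t \<noteq> b" | "z \<in> turn ` T"
        by blast
      then show "z \<in> turn ` T"
      proof cases
        case (1 t)
        then have "t \<in> {a<..<b}"
          by auto
        with assms(1) 1(2) show ?thesis
          by blast
      qed
    qed
  qed (use assms(2) in blast)
  have "compact (turn ` {a..b})"
    by (intro compact_continuous_image continuous_intros) auto
  then have "turn ` {a..b} \<in> sets borel"
    by (simp add: borel_compact)
  moreover have "countable ?F" "countable (turn ` T \<inter> ?F)"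
    by simp_all
  then have "?F \<in> sets borel" "turn ` T \<inter> ?F \<in> sets borel"
    by (auto intro: sets.countable[rotated] simp del: insert_iff)
  ultimately show ?thesis
    by (subst T) (intro sets.Un sets.Diff)
qed

text \<open>Two intervals are needed because an arc may contain the point 1 in its interior.\<close>
lemma arc_pullback:
  assumes "is_interval I"
  obtains T U where "is_interval T" "is_interval U"
    "{t \<in> {0..<1}. turn t \<in> cis ` I} = T \<union> U"
proof -
  define J where "J = {t. 2 * pi * t \<in> I}"
  have J: "x \<in> J" if "a \<in> J" "b \<in> J" "a \<le> x" "x \<le> b" for a b x
    using assms that unfolding J_def is_interval_1 mem_Collect_eq
    by (meson mult_left_mono pi_ge_zero zero_le_mult_iff zero_le_numeral)
  have mem: "turn t \<in> cis ` I \<longleftrightarrow> (\<exists>j::int. t + j \<in> J)" for t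
    by (auto simp: J_def image_iff turn_eq_cis_iff)
  \<comment> \<open>\<open>J\<close> is the arc in turns, and the points over \<open>t\<close> are
    its integer translates. If \<open>J\<close> contains an integer \<open>k\<close>, any translate
    in \<open>J\<close> can be moved towards \<open>k\<close>, into the unit cell just after or just
    before it. Otherwise \<open>J\<close> stays within one cell.\<close>
  obtain k :: int where k: "real_of_int k \<in> J \<or> (\<forall>x\<in>J. \<lfloor>x\<rfloor> = k)"
  proof (cases "\<exists>k::int. real_of_int k \<in> J")
    case False
    have "\<lfloor>x\<rfloor> = \<lfloor>y\<rfloor>" if "x \<in> J" "y \<in> J" "x \<le> y" for x y
    proof (rule ccontr)
      assume "\<lfloor>x\<rfloor> \<noteq> \<lfloor>y\<rfloor>"
      with \<open>x \<le> y\<close> have "\<lfloor>x\<rfloor> < \<lfloor>y\<rfloor>"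
        using floor_mono[of x y] by linarith
      then have "x \<le> real_of_int \<lfloor>y\<rfloor>" "real_of_int \<lfloor>y\<rfloor> \<le> y"
        by linarith+
      with that J False show False
        by blast
    qed
    then have "\<lfloor>x\<rfloor> = \<lfloor>y\<rfloor>" if "x \<in> J" "y \<in> J" for x y
      using that by (metis linear)
    then show ?thesis
      using that by (metis)
  qed (use that in blast)
  let ?T = "{t \<in> {0..<1}. t + real_of_int k \<in> J}"
  let ?U = "{t \<in> {0..<1}. t + real_of_int (k - 1) \<in> J}"
  have int: "is_interval {t \<in> {0..<1}. t + r \<in> J}" for r
    unfolding is_interval_1
  proof (intro ballI allI impI)
    fix a b x
    assume "a \<in> {t \<in> {0..<1}. t + r \<in> J}" "b \<in> {t \<in> {0..<1}. t + r \<in> J}" "a \<le> x \<and> x \<le> b"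
    then show "x \<in> {t \<in> {0..<1}. t + r \<in> J}"
      using J[of "a + r" "b + r" "x + r"] by auto
  qed
  show thesis
  proof (rule that[of ?T ?U])
    show "is_interval ?T" "is_interval ?U"
      by (rule int)+
    show "{t \<in> {0..<1}. turn t \<in> cis ` I} = ?T \<union> ?U"
    proof (intro equalityI subsetI)
      fix t assume "t \<in> {t \<in> {0..<1}. turn t \<in> cis ` I}"
      then obtain j :: int where t: "0 \<le> t" "t < 1" and j: "t + j \<in> J"
        by (auto simp: mem)
      show "t \<in> ?T \<union> ?U"
      proof (cases "real_of_int k \<in> J")
        case False
        then have "\<lfloor>t + j\<rfloor> = k"
          using k j by blast
        then have "j = k"
          using t by linarith
        then show ?thesis
          using t j by simp
      next
        case True
        show ?thesis
        proof (cases "j \<ge> k")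
          case j_ge: True
          \<comment> \<open>\<open>t + k\<close> lies between \<open>k\<close> and
            \<open>t + j\<close>, both of which are in \<open>J\<close>.\<close>
          then have "t + k \<in> J"
            using t by (intro J[OF True j]) auto
          then show ?thesis using t by simp
        next
          case j_lt: False
          then have "real_of_int j \<le> real_of_int (k - 1)"
            by linarith
          \<comment> \<open>Now \<open>t + k - 1\<close> lies between \<open>t + j\<close> and
            \<open>k\<close>, because \<open>t < 1\<close>.\<close>
          then have "t + real_of_int (k - 1) \<in> J"
            using t by (intro J[OF j True]) auto
          then show ?thesis using t by simp
        qed
      qed
    next
      fix t assume "t \<in> ?T \<union> ?U"
      then have "0 \<le> t" "t < 1" "t + real_of_int k \<in> J \<or> t + real_of_int (k - 1) \<in> J"
        by auto
      then show "t \<in> {t \<in> {0..<1}. turn t \<in> cis ` I}"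
        unfolding mem mem_Collect_eq atLeastLessThan_iff by blast
    qed
  qed
qed

section \<open>Length of combs and of their intersections with arcs\<close>

lemma compact_comb: "compact (comb n s)"
  unfolding comb_def by (intro compact_UN) auto

text \<open>This keeps the comb inside the interval on which \<open>turn\<close> is
  injective.\<close>

lemma comb_subset:
  assumes "s < 1"
  shows "comb n s \<subseteq> {0..<1}"
proof
  fix x assume "x \<in> comb n s"
  then obtain j where j: "j < n" "real j / n \<le> x" "x \<le> (real j + s) / n"
    by (auto simp: comb_def)
  have "real j + s < real n"
    using j assms by linarith
  then have "(real j + s) / n < 1"
    using j by (simp add: divide_simps)
  moreover have "0 \<le> real j / n"
    by simp
  ultimately show "x \<in> {0..<1}"
    using j(2,3) unfolding atLeastLessThan_iff by linarith
qed

text \<open>For \<open>s < 1\<close> consecutive teeth leave a gap, so they are disjoint and their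
  lengths \<open>s / n\<close> add up.\<close>

lemma measure_comb:
  assumes "0 < n" "0 \<le> s" "s < 1"
  shows "measure lborel (comb n s) = s"
proof -
  have disj: "disjoint_family_on (\<lambda>j. {real j / n .. (real j + s) / n}) {..<n}"
    unfolding disjoint_family_on_def
  proof (intro ballI impI)
    fix i j :: nat assume "i \<noteq> j"
    show "{real i / n .. (real i + s) / n} \<inter> {real j / n .. (real j + s) / n} = {}"
    proof (rule ccontr)
      assume "\<not> ?thesis"
      then obtain x where "x \<in> {real i / n .. (real i + s) / n} \<inter> {real j / n .. (real j + s) / n}"
        by blast
      then have "real i / n \<le> (real j + s) / n" "real j / n \<le> (real i + s) / n"
        by simp_all
      then have "real i \<le> real j + s" "real j \<le> real i + s"
        using assms(1) by (simp_all add: divide_le_cancel)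
      with assms(3) \<open>i \<noteq> j\<close> show False
        by linarith
    qed
  qed
  have "measure lborel (comb n s) = (\<Sum>j<n. measure lborel {real j / n .. (real j + s) / n})"
    unfolding comb_def by (intro measure_finite_Union disj) (auto simp: emeasure_lborel_Icc_eq)
  also have "\<dots> = (\<Sum>j<n. s / n)"
    using assms by (intro sum.cong refl) (simp add: divide_right_mono add_divide_distrib)
  also have "\<dots> = s"
    using assms by simp
  finally show ?thesis .
qed

text \<open>Teeth are counted: about \<open>n * (b - a)\<close> of them meet the interval, each of
  length \<open>s / n\<close>, and the term \<open>2 / n\<close> absorbs boundary effects.\<close>

lemma measure_comb_Int_le:
  assumes "0 < n" "0 \<le> s" "s < 1" "0 \<le> a" "a \<le> b"
  shows "measure lborel (comb n s \<inter> {a..b}) \<le> s * (b - a + 2 / n)"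
proof -
  \<comment> \<open>A tooth \<open>j\<close> that meets \<open>{a..b}\<close> satisfies
    \<open>j <= n * b\<close> and \<open>n * a <= j + s < j + 1\<close>, so \<open>j\<close> lies
    between the two floors.\<close>
  define K where "K = {nat \<lfloor>n * a\<rfloor>..nat \<lfloor>n * b\<rfloor>}"
  let ?c = "\<lambda>j. {real j / n .. (real j + s) / n}"
  have sub: "comb n s \<inter> {a..b} \<subseteq> (\<Union>j\<in>K. ?c j)"
  proof
    fix x assume x: "x \<in> comb n s \<inter> {a..b}"
    then obtain j where j: "real j / n \<le> x" "x \<le> (real j + s) / n"
      by (auto simp: comb_def)
    have "real j \<le> n * x" "n * x \<le> real j + s" "n * x \<le> n * b" "n * a \<le> n * x"
      using j x assms(1) by (auto simp: field_simps)
    then have "j \<in> K"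
      using assms(3) unfolding K_def by (auto simp: nat_le_iff le_nat_iff le_floor_iff floor_le_iff)
    then show "x \<in> (\<Union>j\<in>K. ?c j)"
      using j by auto
  qed
  have "0 \<le> n * a" "n * a \<le> n * b"
    using assms by (auto simp: mult_left_mono)
  \<comment> \<open>One unit comes from counting both end indices, the other from rounding
    \<open>n * a\<close> down.\<close>
  then have card: "real (card K) \<le> n * (b - a) + 2"
    unfolding K_def right_diff_distrib card_atLeastAtMost by linarith
  have "measure lborel (comb n s \<inter> {a..b}) \<le> measure lborel (\<Union>j\<in>K. ?c j)"
  proof (rule measure_mono_fmeasurable[OF sub])
    show "comb n s \<inter> {a..b} \<in> sets lborel"
      using compact_comb[of n s] by (auto intro: borel_compact)
    show "(\<Union>j\<in>K. ?c j) \<in> fmeasurable lborel"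
      by (intro fmeasurable.finite_UN) (auto simp: K_def emeasure_lborel_Icc_eq intro!: fmeasurableI)
  qed
  also have "\<dots> \<le> (\<Sum>j\<in>K. measure lborel (?c j))"
    by (intro measure_UNION_le) (auto simp: K_def)
  also have "\<dots> = (\<Sum>j\<in>K. s / n)"
    using assms by (intro sum.cong refl) (simp add: divide_right_mono add_divide_distrib)
  also have "\<dots> = card K * (s / n)"
    by simp
  also have "\<dots> \<le> (n * (b - a) + 2) * (s / n)"
    using card assms by (intro mult_right_mono) auto
  also have "\<dots> = s * (b - a + 2 / n)"
    using assms by (simp add: field_simps)
  finally show ?thesis .
qed

lemma turn_comb:
  assumes "s < 1"
  shows "turn ` comb n s \<in> sets borel" "turn ` comb n s \<subseteq> unit_circle"
    and "{t \<in> {0..<1}. turn t \<in> turn ` comb n s} = comb n s"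
proof -
  have "compact (turn ` comb n s)"
    by (intro compact_continuous_image compact_comb continuous_intros)
  then show "turn ` comb n s \<in> sets borel"
    by (rule borel_compact)
  show "{t \<in> {0..<1}. turn t \<in> turn ` comb n s} = comb n s"
    using comb_subset[OF assms, of n] inj_on_turn by (fastforce dest: inj_onD)
qed auto

text \<open>An arc is the image of its preimage in \<open>{0..<1}\<close>, a union of two intervals,
  and each of these has a Borel image.\<close>

lemma arc_pullback_intervals:
  assumes "\<omega> \<in> circle_arcs"
  obtains T U a b c d where "{t \<in> {0..<1}. turn t \<in> \<omega>} = T \<union> U"
    "0 \<le> a" "a \<le> b" "{a<..<b} \<subseteq> T" "T \<subseteq> {a..b}"
    "0 \<le> c" "c \<le> d" "{c<..<d} \<subseteq> U" "U \<subseteq> {c..d}"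
    "\<omega> \<in> sets borel" "\<omega> \<subseteq> unit_circle"
proof -
  obtain I where I: "is_interval I" "\<omega> = cis ` I"
    using assms by (auto simp: circle_arcs_def)
  obtain T U where TU: "is_interval T" "is_interval U" "{t \<in> {0..<1}. turn t \<in> \<omega>} = T \<union> U"
    using arc_pullback[OF I(1)] I(2) by metis
  then have sub: "T \<subseteq> {0..<1}" "U \<subseteq> {0..<1}"
    by blast+
  obtain a b where ab: "0 \<le> a" "a \<le> b" "{a<..<b} \<subseteq> T" "T \<subseteq> {a..b}"
    using interval_between[OF TU(1) sub(1)] by metis
  obtain c d where cd: "0 \<le> c" "c \<le> d" "{c<..<d} \<subseteq> U" "U \<subseteq> {c..d}"
    using interval_between[OF TU(2) sub(2)] by metis
  have circ: "\<omega> \<subseteq> unit_circle"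
    using I(2) by auto
  have "\<omega> = turn ` {t \<in> {0..<1}. turn t \<in> \<omega>}"
    using circ turn_range by auto
  also have "\<dots> = turn ` T \<union> turn ` U"
    unfolding TU(3) by (rule image_Un)
  also have "\<dots> \<in> sets borel"
    using turn_image_borel[OF ab(3,4)] turn_image_borel[OF cd(3,4)] by (rule sets.Un)
  finally have "\<omega> \<in> sets borel" .
  with that TU(3) ab cd circ show thesis
    by blast
qed

text \<open>The factor 2 counts the two intervals of the preimage, each of which is at most as long
  as the arc.\<close>

lemma measure_turn_comb_Int_le:
  assumes "\<omega> \<in> circle_arcs" "0 < n" "0 \<le> s" "s < 1"
  shows "measure circle_measure (turn ` comb n s \<inter> \<omega>) \<le> 2 * s * (measure circle_measure \<omega> + 2 / n)"
proof -
  obtain T U a b c d where TU: "{t \<in> {0..<1}. turn t \<in> \<omega>} = T \<union> U"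
    and ab: "0 \<le> a" "a \<le> b" "{a<..<b} \<subseteq> T" "T \<subseteq> {a..b}"
    and cd: "0 \<le> c" "c \<le> d" "{c<..<d} \<subseteq> U" "U \<subseteq> {c..d}"
    and \<omega>: "\<omega> \<in> sets borel" "\<omega> \<subseteq> unit_circle"
    using arc_pullback_intervals[OF assms(1)] .
  let ?r = "measure circle_measure \<omega>" and ?A = "comb n s"
  note E = turn_comb[OF assms(4), of n]
  have r: "?r = measure lborel (T \<union> U)"
    using circle_measure_borel(2)[OF \<omega>] unfolding TU .
  have sets: "T \<in> sets borel" "U \<in> sets borel" "?A \<in> sets borel"
    using interval_borel[OF ab(3,4)] interval_borel[OF cd(3,4)] compact_comb[of n s]
    by (auto intro: borel_compact)
  have unit: "{0..1::real} \<in> fmeasurable lborel"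
    by (rule fmeasurableI) auto
  have "T \<union> U \<subseteq> {0..1}"
    unfolding TU[symmetric] by auto
  then have "T \<union> U \<in> fmeasurable lborel"
    using sets by (intro fmeasurableI2[OF unit]) auto
  \<comment> \<open>Each length is bounded by that of the union by monotonicity alone; no
    disjointness of \<open>T\<close> and \<open>U\<close> enters.\<close>
  then have "measure lborel {a<..<b} \<le> ?r" "measure lborel {c<..<d} \<le> ?r"
    unfolding r using ab(3) cd(3) by (intro measure_mono_fmeasurable; auto)+
  then have len: "b - a \<le> ?r" "d - c \<le> ?r"
    using ab(2) cd(2) by auto
  have "measure circle_measure (turn ` ?A \<inter> \<omega>)
      = measure lborel {t \<in> {0..<1}. turn t \<in> turn ` ?A \<inter> \<omega>}"
    using E \<omega> by (intro circle_measure_borel) auto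
  also have "{t \<in> {0..<1}. turn t \<in> turn ` ?A \<inter> \<omega>} = ?A \<inter> (T \<union> U)"
    using E(3) TU by blast
  also have "measure lborel \<dots> \<le> measure lborel (?A \<inter> {a..b} \<union> ?A \<inter> {c..d})"
  proof (rule measure_mono_fmeasurable)
    show "?A \<inter> {a..b} \<union> ?A \<inter> {c..d} \<in> fmeasurable lborel"
      using sets comb_subset[OF assms(4), of n] by (intro fmeasurableI2[OF unit]) auto
  qed (use sets ab cd in auto)
  also have "\<dots> \<le> measure lborel (?A \<inter> {a..b}) + measure lborel (?A \<inter> {c..d})"
    using sets by (intro measure_Un_le) auto
  also have "\<dots> \<le> s * (b - a + 2 / n) + s * (d - c + 2 / n)"
    using assms ab cd by (intro add_mono measure_comb_Int_le) auto
  also have "\<dots> \<le> s * (?r + 2 / n) + s * (?r + 2 / n)"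
    using len assms(3) by (intro add_mono mult_left_mono) auto
  finally show ?thesis
    by (simp add: algebra_simps)
qed

section \<open>Morrey norms of indicators\<close>

text \<open>Sets outside the sigma-algebra have \<open>emeasure\<close> 0 by convention, so the
  positivity in \<open>circle_arcs\<close> already yields measurability.\<close>

lemma measure_arc:
  assumes "\<omega> \<in> circle_arcs"
  shows "\<omega> \<in> sets circle_measure" "0 < measure circle_measure \<omega>" "measure circle_measure \<omega> \<le> 1"
proof -
  interpret finite_measure circle_measure
    by (rule finite_measure_circle_measure)
  have pos: "0 < emeasure circle_measure \<omega>"
    using assms by (auto simp: circle_arcs_def)
  then show "\<omega> \<in> sets circle_measure"
    by (metis emeasure_notin_sets less_irrefl)
  show "0 < measure circle_measure \<omega>"
    using pos by (simp add: emeasure_eq_measure)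
  have "measure circle_measure \<omega> \<le> measure circle_measure (space circle_measure)"
    by (rule bounded_measure)
  also have "\<dots> = 1"
    by (simp add: space_circle_measure emeasure_circle_measure_space measure_def)
  finally show "measure circle_measure \<omega> \<le> 1" .
qed

text \<open>The values 0 and 1 are fixed by \<open>powr p\<close> for every real \<open>p\<close>,
  as \<open>0 powr p = 0\<close>; only the outer root remains. All quantities are finite, so the
  infinite branch of \<open>ennreal_powr\<close> does not occur.\<close>

lemma morrey_norm_indicator:
  assumes "E \<in> sets circle_measure"
  shows "morrey_norm p l (indicator E) = (SUP \<omega>\<in>circle_arcs.
    ennreal ((measure circle_measure (E \<inter> \<omega>) / measure circle_measure \<omega> powr l) powr (1 / p)))"
  unfolding morrey_norm_def
proof (rule SUP_cong[OF refl])
  interpret finite_measure circle_measure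
    by (rule finite_measure_circle_measure)
  fix \<omega> assume \<omega>: "\<omega> \<in> circle_arcs"
  have "(\<integral>\<^sup>+\<zeta>\<in>\<omega>. ennreal (norm (indicator E \<zeta> :: complex) powr p) \<partial>circle_measure)
      = (\<integral>\<^sup>+\<zeta>. indicator (E \<inter> \<omega>) \<zeta> \<partial>circle_measure)"
    by (intro nn_integral_cong) (auto simp: indicator_def)
  also have "\<dots> = ennreal (measure circle_measure (E \<inter> \<omega>))"
    using assms measure_arc(1)[OF \<omega>] by (simp add: emeasure_eq_measure)
  finally show "ennreal_powr (ennreal (1 / measure circle_measure \<omega> powr l) *
      (\<integral>\<^sup>+\<zeta>\<in>\<omega>. ennreal (norm (indicator E \<zeta> :: complex) powr p) \<partial>circle_measure)) (1 / p)
    = ennreal ((measure circle_measure (E \<inter> \<omega>) / measure circle_measure \<omega> powr l) powr (1 / p))"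
    by (simp add: ennreal_powr_def flip: ennreal_mult)
qed

text \<open>Reduces upper bounds to a growth condition over arcs; applied with \<open>K = 1\<close>
  and with \<open>K = 6 * s\<close>.\<close>

lemma morrey_norm_indicator_le:
  assumes "E \<in> sets circle_measure" "0 < p"
    and "\<And>\<omega>. \<omega> \<in> circle_arcs \<Longrightarrow>
      measure circle_measure (E \<inter> \<omega>) \<le> K * measure circle_measure \<omega> powr l"
  shows "morrey_norm p l (indicator E) \<le> ennreal (K powr (1 / p))"
  unfolding morrey_norm_indicator[OF assms(1)]
proof (intro SUP_least ennreal_leI powr_mono2)
  fix \<omega> assume \<omega>: "\<omega> \<in> circle_arcs"
  then have "measure circle_measure \<omega> powr l > 0"
    using measure_arc(2)[OF \<omega>] by simp
  then show "measure circle_measure (E \<inter> \<omega>) / measure circle_measure \<omega> powr l \<le> K"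
    using assms(3)[OF \<omega>] by (simp add: pos_divide_le_eq)
qed (use assms(2) in auto)

text \<open>An arc of measure \<open>r <= 1\<close> has \<open>r <= r powr l\<close>. Hence
  indicators lie in the Morrey space, where the norm equivalence may be applied to them.\<close>

lemma morrey_norm_indicator_le_1:
  assumes "E \<in> sets circle_measure" "0 < p" "l < 1"
  shows "morrey_norm p l (indicator E) \<le> 1"
proof -
  interpret finite_measure circle_measure
    by (rule finite_measure_circle_measure)
  have "morrey_norm p l (indicator E) \<le> ennreal (1 powr (1 / p))"
  proof (rule morrey_norm_indicator_le[OF assms(1,2)])
    fix \<omega> assume \<omega>: "\<omega> \<in> circle_arcs"
    have "measure circle_measure (E \<inter> \<omega>) \<le> measure circle_measure \<omega> powr 1"
      using assms(1) measure_arc[OF \<omega>] by (auto intro!: finite_measure_mono)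
    also have "\<dots> \<le> measure circle_measure \<omega> powr l"
      using measure_arc[OF \<omega>] assms(3) by (intro powr_mono') auto
    finally show "measure circle_measure (E \<inter> \<omega>) \<le> 1 * measure circle_measure \<omega> powr l"
      by simp
  qed
  then show ?thesis
    by simp
qed

lemma measure_turn_comb:
  assumes "0 < n" "0 \<le> s" "s < 1"
  shows "turn ` comb n s \<in> sets circle_measure" "measure circle_measure (turn ` comb n s) = s"
  using circle_measure_borel[OF turn_comb(1,2)[OF assms(3)]] turn_comb(3)[OF assms(3)]
    measure_comb[OF assms] by simp_all

text \<open>A comb with one tooth is itself an arc, so the supremum can be tested on it.\<close>

lemma morrey_norm_single_arc_ge:
  assumes "0 < s" "s < 1"
  shows "ennreal (s powr ((1 - l) / p)) \<le> morrey_norm p l (indicator (turn ` comb 1 s))"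
proof -
  interpret finite_measure circle_measure
    by (rule finite_measure_circle_measure)
  let ?E = "turn ` comb 1 s"
  have E: "?E \<in> sets circle_measure" "measure circle_measure ?E = s"
    using measure_turn_comb[of 1 s] assms by auto
  have "?E = cis ` {0..2 * pi * s}"
  proof -
    have "comb 1 s = {0..s}"
      by (auto simp: comb_def)
    moreover have "(\<lambda>t. 2 * pi * t) ` {0..s} = {0..2 * pi * s}"
      using assms by (simp add: image_mult_atLeastAtMost)
    ultimately show ?thesis
      by (metis image_image)
  qed
  then have "?E \<in> circle_arcs"
    unfolding circle_arcs_def using E assms
    by (auto simp: emeasure_eq_measure intro!: exI[of _ "{0..2 * pi * s}"] is_interval_cc)
  then have "ennreal ((measure circle_measure (?E \<inter> ?E) / measure circle_measure ?E powr l) powr (1 / p))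
      \<le> morrey_norm p l (indicator ?E)"
    unfolding morrey_norm_indicator[OF E(1)] by (rule SUP_upper)
  moreover have "s / s powr l = s powr (1 - l)"
    using assms by (simp add: powr_diff)
  ultimately show ?thesis
    using E(2) by (simp add: powr_powr)
qed

text \<open>Arcs of measure at least the period \<open>1 / n\<close> see the comb as having density
  about \<open>s\<close>. For shorter arcs the trivial bound by the whole arc is enough, thanks to
  the last hypothesis on \<open>n\<close>.\<close>

lemma morrey_norm_comb_le:
  assumes "0 < s" "s < 1" "0 < p" "l < 1" "0 < n" "(1 / n) powr (1 - l) \<le> s"
  shows "morrey_norm p l (indicator (turn ` comb n s)) \<le> ennreal ((6 * s) powr (1 / p))"
proof (rule morrey_norm_indicator_le)
  interpret finite_measure circle_measure
    by (rule finite_measure_circle_measure)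
  show E: "turn ` comb n s \<in> sets circle_measure"
    using measure_turn_comb assms by auto
  fix \<omega> assume \<omega>: "\<omega> \<in> circle_arcs"
  let ?r = "measure circle_measure \<omega>"
  note r = measure_arc[OF \<omega>]
  have r_l: "?r \<le> ?r powr l"
    using powr_mono'[of l 1 ?r] r assms by simp
  show "measure circle_measure (turn ` comb n s \<inter> \<omega>) \<le> 6 * s * ?r powr l"
  proof (cases "1 / n \<le> ?r")
    case True
    have "measure circle_measure (turn ` comb n s \<inter> \<omega>) \<le> 2 * s * (?r + 2 / n)"
      using measure_turn_comb_Int_le[OF \<omega>] assms by simp
    \<comment> \<open>From \<open>1 / n <= ?r\<close>; this is the origin of the constant 6.\<close>
    also have "\<dots> \<le> 2 * s * (3 * ?r)"
      using True assms by (intro mult_left_mono) auto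
    also have "\<dots> \<le> 6 * s * ?r powr l"
      using r_l assms by simp
    finally show ?thesis .
  next
    case False
    have "measure circle_measure (turn ` comb n s \<inter> \<omega>) \<le> ?r"
      using r by (intro finite_measure_mono) auto
    \<comment> \<open>Splitting off \<open>?r powr (1 - l)\<close> leaves a factor that a short arc
      makes at most \<open>s\<close>.\<close>
    also have "\<dots> = ?r powr (1 - l) * ?r powr l"
      using r by (simp flip: powr_add)
    also have "?r powr (1 - l) \<le> (1 / n) powr (1 - l)"
      using False r assms by (intro powr_mono2) auto
    also have "(1 / n) powr (1 - l) \<le> 6 * s"
      using assms by linarith
    finally show ?thesis
      by (simp add: mult_right_mono)
  qed
qed (use assms in auto)

section \<open>Equimeasurable indicators and the contradiction\<close>

text \<open>The only nonempty level sets of an indicator at levels \<open>s >= 0\<close> are the set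
  itself, for \<open>s < 1\<close>.\<close>

lemma equimeasurable_indicator:
  assumes "emeasure M E = emeasure M F" "E \<in> sets M" "F \<in> sets M"
  shows "equimeasurable M (indicator E) (indicator F)"
  unfolding equimeasurable_def
proof (intro allI impI)
  fix s :: real assume "s \<ge> 0"
  have "{x \<in> space M. norm (indicator A x :: complex) > s} = (if s < 1 then A else {})"
    if "A \<in> sets M" for A
    using sets.sets_into_space[OF that] \<open>s \<ge> 0\<close> by (auto simp: indicator_def)
  then show "emeasure M {x \<in> space M. norm (indicator E x :: complex) > s}
      = emeasure M {x \<in> space M. norm (indicator F x :: complex) > s}"
    using assms by simp
qed

theorem mainTheorem2:
  fixes p l :: real
  assumes "1 \<le> p" and "0 < l" and "l < 1"
  shows "\<not> (\<exists>\<rho>. banach_function_norm circle_measure \<rho> \<and>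
              rearrangement_invariant circle_measure \<rho> \<and>
              bfs circle_measure \<rho> = morrey_space p l \<and>
              equivalent_norms_on (morrey_space p l) (bfs_norm \<rho>) (morrey_norm p l))"
proof
  interpret finite_measure circle_measure
    by (rule finite_measure_circle_measure)
  assume "\<exists>\<rho>. banach_function_norm circle_measure \<rho> \<and>
              rearrangement_invariant circle_measure \<rho> \<and>
              bfs circle_measure \<rho> = morrey_space p l \<and>
              equivalent_norms_on (morrey_space p l) (bfs_norm \<rho>) (morrey_norm p l)"
  then obtain \<rho> where ri: "rearrangement_invariant circle_measure \<rho>"
    and "equivalent_norms_on (morrey_space p l) (bfs_norm \<rho>) (morrey_norm p l)"
    by (elim exE conjE)
  then obtain c C where c: "c > 0" and C: "C > 0"
    and equiv: "\<And>f. f \<in> morrey_space p l \<Longrightarrow>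
      ennreal c * morrey_norm p l f \<le> bfs_norm \<rho> f \<and> bfs_norm \<rho> f \<le> ennreal C * morrey_norm p l f"
    unfolding equivalent_norms_on_def by blast
  have p: "0 < p" "p \<noteq> 0"
    using assms(1) by auto
  have space: "indicator E \<in> morrey_space p l" if "E \<in> sets circle_measure" for E
    using morrey_norm_indicator_le_1[OF that p(1) assms(3)] that
    by (auto simp: morrey_space_def intro: le_less_trans)
  \<comment> \<open>The number \<open>n\<close> of arcs depends on \<open>s\<close> but drops out of
    the inequality, while \<open>c\<close> and \<open>C\<close> do not depend on
    \<open>s\<close>.\<close>
  have bound: "c * s powr ((1 - l) / p) \<le> C * (6 * s) powr (1 / p)" if s: "0 < s" "s < 1" for s
  proof -
    \<comment> \<open>Since \<open>1 - l > 0\<close>, large \<open>n\<close> satisfy the hypothesis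
      of \<open>morrey_norm_comb_le\<close>.\<close>
    have "((\<lambda>n. (1 / real n) powr (1 - l)) \<longlongrightarrow> 0) sequentially"
      using assms(3) by (intro tendsto_eq_intros lim_1_over_n | simp)+
    then have "\<forall>\<^sub>F n in sequentially. (1 / real n) powr (1 - l) < s"
      using s(1) by (rule order_tendstoD)
    with eventually_gt_at_top[of 0]
    have "\<forall>\<^sub>F n in sequentially. 0 < n \<and> (1 / real n) powr (1 - l) < s"
      by (rule eventually_conj)
    then obtain n where n: "0 < n" "(1 / real n) powr (1 - l) < s"
      by (metis (mono_tags, lifting) eventually_sequentially order_refl)
    let ?E = "\<lambda>n. turn ` comb n s"
    have E: "?E m \<in> sets circle_measure" "measure circle_measure (?E m) = s" if "0 < m" for m
      using measure_turn_comb[of m s] s that by auto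
    have "ennreal (c * s powr ((1 - l) / p)) = ennreal c * ennreal (s powr ((1 - l) / p))"
      using c by (simp add: ennreal_mult)
    also have "\<dots> \<le> ennreal c * morrey_norm p l (indicator (?E 1))"
      using s by (intro mult_left_mono morrey_norm_single_arc_ge) auto
    also have "\<dots> \<le> bfs_norm \<rho> (indicator (?E 1))"
      using equiv space E by simp
    also have "\<dots> = bfs_norm \<rho> (indicator (?E n))"
    proof -
      have "equimeasurable circle_measure (indicator (?E 1)) (indicator (?E n))"
        using E n(1) by (intro equimeasurable_indicator) (auto simp: emeasure_eq_measure)
      then show ?thesis
        using ri E n(1) unfolding rearrangement_invariant_def by simp
    qed
    also have "\<dots> \<le> ennreal C * morrey_norm p l (indicator (?E n))"
      using equiv space E n(1) by simp
    also have "\<dots> \<le> ennreal C * ennreal ((6 * s) powr (1 / p))"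
      using s n p assms by (intro mult_left_mono morrey_norm_comb_le) auto
    also have "\<dots> = ennreal (C * (6 * s) powr (1 / p))"
      using C by (simp add: ennreal_mult)
    finally show ?thesis
      using C by (simp add: ennreal_le_iff)
  qed
  \<comment> \<open>Dividing \<open>bound\<close> by its power of \<open>s\<close> leaves the
    exponent \<open>1 / p - (1 - l) / p = l / p\<close>. It is positive because
    \<open>0 < l\<close>, so the right-hand side vanishes as \<open>s\<close> tends to 0 and forces
    \<open>c <= 0\<close>.\<close>
  have "c \<le> C * 6 powr (1 / p) * s powr (l / p)" if s: "0 < s" "s < 1" for s
  proof -
    have "c * s powr ((1 - l) / p) \<le> C * 6 powr (1 / p) * s powr (l / p) * s powr ((1 - l) / p)"
      using bound[OF s] s by (simp add: powr_mult mult.assoc flip: powr_add add_divide_distrib)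
    then show ?thesis
      using s by simp
  qed
  then have "\<forall>\<^sub>F s in at_right 0. c \<le> C * 6 powr (1 / p) * s powr (l / p)"
    by (auto simp: eventually_at_right_field intro!: exI[of _ 1])
  moreover have "((\<lambda>s. C * 6 powr (1 / p) * s powr (l / p)) \<longlongrightarrow> C * 6 powr (1 / p) * 0) (at_right 0)"
  proof (intro tendsto_mult tendsto_const)
    show "((\<lambda>s. s powr (l / p)) \<longlongrightarrow> 0) (at_right 0)"
      using assms(2) p by (auto intro!: tendsto_eq_intros simp: eventually_at_right_field)
  qed
  ultimately have "c \<le> C * 6 powr (1 / p) * 0"
    by (intro tendsto_lowerbound) auto
  with c show False
    by simp
qed

end
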